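(* Consider the setting with $n\ge2$ decision makers described in the context. Fix a round $t$ and suppose: (H1) $\mathcal{E}_t=\boldsymbol{\mathcal{E}}$ for a fixed matrix $\boldsymbol{\mathcal{E}}\in\mathbb{R}^{m\times d}$ common to all agents; (H2) $\gamma_{jt}=\gamma_j$ for constants $\gamma_j\ge0$ ($j=1,\dots,n$) common to all agents, and $Z_t$ is conditionally independent of $\{X_t,B_t\}$ given $\{W_{jt}\}_{j=1}^n$; and, for every decision maker $j\in\{1,\dots,n\}$: (M1) $\mathrm{cBP}_j(\{\boldsymbol{\theta}_{jt},\boldsymbol{\theta}_t^{-j}\})=g_j(\boldsymbol{\theta}_{jt})+h_j(\boldsymbol{\theta}_t^{-j})+c_j$ for some functions $g_j,h_j$ and constant $c_j$; (M2) $g_j(\boldsymbol{\theta}_{jt})=\boldsymbol{\alpha}_j^\top\boldsymbol{\theta}_{jt}+\beta_j$ for some $\boldsymbol{\alpha}_j\in\mathbb{R}^m$, $\beta_j\in\mathbb{R}$; (M3) the admissible parameters satisfy $\|\boldsymbol{\theta}_{jt}\|_2\le1$. Let $\boldsymbol{\theta}_j^{\mathrm{AO}}=\dfrac{\boldsymbol{\alpha}_j+\gamma_j\boldsymbol{\mathcal{E}}\boldsymbol{\mathcal{E}}^\top\boldsymbol{\theta}_j^*}{\|\boldsymbol{\alpha}_j+\gamma_j\boldsymbol{\mathcal{E}}\boldsymbol{\mathcal{E}}^\top\boldsymbol{\theta}_j^*\|_2}$ (assuming the denominators are nonzero), and suppose each decision maker considers only the two choices $\boldsymbol{\theta}_{jt}\in\{\boldsymbol{\theta}_j^*,\boldsymbol{\theta}_j^{\mathrm{AO}}\}$,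 $j=1,\dots,n$. Let $i$ be an arbitrary decision maker with $\boldsymbol{\theta}_i^{\mathrm{AO}}\neq\boldsymbol{\theta}_i^*$, and suppose: (1) $\|\boldsymbol{\theta}_i^*\|_2\le1$; (2) $\boldsymbol{\alpha}_j=(k_j-\gamma_j)\boldsymbol{\mathcal{E}}\boldsymbol{\mathcal{E}}^\top\boldsymbol{\theta}_j^*$ with $k_j,\gamma_j>0$ for all $j=1,\dots,n$; (3) $\boldsymbol{\theta}_{jt}^\top\boldsymbol{\mathcal{E}}\boldsymbol{\mathcal{E}}^\top(\boldsymbol{\theta}_i^{\mathrm{AO}}-\boldsymbol{\theta}_i^* )\ge0$ for all $j\ne i$; (4) $B_t\sim\mathcal{N}(0,\sigma^2I)$ with $I$ the identity matrix and $\sigma>0$; (5) the selection rule of $i$ has the form $\boldsymbol{\delta}_{\boldsymbol{\theta}_{it}}(\mathbf{x})=\widetilde{\boldsymbol{\delta}}_i(\hat y_{it})$ with $\hat y_{it}=\mathbf{x}^\top\boldsymbol{\theta}_{it}$, where $\widetilde{\boldsymbol{\delta}}_i$ is increasing and Lipschitz: $|\widetilde{\boldsymbol{\delta}}_i(\hat y)-\widetilde{\boldsymbol{\delta}}_i(\hat y')|\le L|\hat y-\hat y'|$ for some $L>0$. Put $\boldsymbol{\theta}_\bullet^{\mathrm{all}}=\{\boldsymbol{\theta}_t^{-i},\boldsymbol{\theta}_i^*\}$ and $\boldsymbol{\theta}_\diamond^{\mathrm{all}}=\{\boldsymbol{\theta}_t^{-i},\boldsymbol{\theta}_i^{\mathrm{AO}}\}$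 (same $\boldsymbol{\theta}_t^{-i}$), let $\xi_i(\boldsymbol{\theta}_t^{\mathrm{all}}):=p(W_{it}=1\mid B_t;\boldsymbol{\theta}_t^{\mathrm{all}})$ be the admission chance of agent $t$ with decision maker $i$, let $\mathbf{a}_t(\boldsymbol{\theta}_t^{\mathrm{all}})$ be the agent's optimal action, and let $\Phi$ be the cumulative distribution function of $\mathcal{N}(0,1)$. Then $$\lambda:=\big(\mathbf{a}_t(\boldsymbol{\theta}_\diamond^{\mathrm{all}})\big)^\top\boldsymbol{\mathcal{E}}^\top\boldsymbol{\theta}_i^{\mathrm{AO}}-\big(\mathbf{a}_t(\boldsymbol{\theta}_\bullet^{\mathrm{all}})\big)^\top\boldsymbol{\mathcal{E}}^\top\boldsymbol{\theta}_i^*\ge0,$$ and for any $M>0$, $$p\big(\xi_i(\boldsymbol{\theta}_\bullet^{\mathrm{all}})-\xi_i(\boldsymbol{\theta}_\diamond^{\mathrm{all}})>M\big)\le\Phi\!\left(\frac{-M/L-\lambda}{\sigma\|\boldsymbol{\theta}_i^{\mathrm{AO}}-\boldsymbol{\theta}_i^*\|_2}\right).$$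
   Context: Setting with $n$ decision makers (DMs). In round $t$ each DM $i$ publishes a parameter vector $\boldsymbol{\theta}_{it}\in\mathbb{R}^m$ and a selection rule $\boldsymbol{\delta}_{\boldsymbol{\theta}_{it}}:\mathbb{R}^m\to[0,1]$. Write $\boldsymbol{\theta}_t^{\mathrm{all}}=\{\boldsymbol{\theta}_{it},\boldsymbol{\theta}_t^{-i}\}=\{\boldsymbol{\theta}_{jt}\}_{j=1}^n$, where $\boldsymbol{\theta}_t^{-i}$ collects the parameters of all DMs other than $i$. An agent arrives with random baseline $B_t\in\mathbb{R}^m$, effort conversion matrix $\mathcal{E}_t\in\mathbb{R}^{m\times d}$ and real-valued noises $O_{it}$ (possibly correlated with $B_t$). If the agent takes action $\mathbf{a}\in\mathbb{R}^d$, its covariates are $X_t=B_t+\mathcal{E}_t\mathbf{a}$ and its predicted outcomes are $\hat y_{it}=X_t^\top\boldsymbol{\theta}_{it}$. The agent chooses the action maximising $\sum_{i}\gamma_{it}\hat y_{it}-\frac12\|\mathbf{a}\|_2^2$ (with $\gamma_{it}\ge0$), i.e. $\mathbf{a}_t=\mathbf{a}_t(\boldsymbol{\theta}_t^{\mathrm{all}})=\mathcal{E}_t^\top\sum_{j=1}^n\gamma_{jt}\boldsymbol{\theta}_{jt}$. Selection statuses $W_{it}\in\{0,1\}$ satisfy $W_{it}\sim\mathrm{Bernoulli}(\boldsymbol{\delta}_{\boldsymbol{\theta}_{it}}(X_t))$ given $X_t$, and $Z_t\in\{0,1,\dots,n\}$ indicates the DM whose positive decision the agent complies with ($0$ if none).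 The potential outcome with DM $i$ is $Y_{it}=X_t^\top\boldsymbol{\theta}_i^*+O_{it}$, with $\boldsymbol{\theta}_i^*\in\mathbb{R}^m$ fixed. "$;\boldsymbol{\theta}_t^{\mathrm{all}}$" indicates the distribution induced by deploying $\boldsymbol{\theta}_t^{\mathrm{all}}$; the same baseline $B_t$ is used when comparing different deployed parameters. The conditional base performance of DM $i$ is $\mathrm{cBP}_i(\boldsymbol{\theta}_t^{\mathrm{all}})=\mathbb{E}[B_t^\top\boldsymbol{\theta}_i^*+O_{it}\mid Z_t=i;\boldsymbol{\theta}_t^{\mathrm{all}}]$ (assumed well defined). *)

theory Defs
  imports "HOL-Probability.Probability"
begin

text \<open>
  Decision makers (DMs) are the elements of a finite type \<open>'n\<close>. A profile
  \<open>\<theta> :: 'n \<Rightarrow> real^'m\<close> gives the parameters deployed by all of them in the round under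
  consideration. The parameters \<open>\<theta>\<^sup>-\<^sup>i\<close> of all DMs but \<open>i\<close> are
  \<open>restrict \<theta> (- {i})\<close>, and \<open>\<theta>(i := x)\<close> is the profile \<open>{x, \<theta>\<^sup>-\<^sup>i}\<close>.
\<close>

type_synonym ('n, 'm) profile = "'n \<Rightarrow> real^'m"

definition admissible :: "('n, 'm::finite) profile \<Rightarrow> bool" where
  "admissible \<theta> \<longleftrightarrow> (\<forall>j. norm (\<theta> j) \<le> 1)"

section \<open>Agents\<close>

definition agent_utility ::
  "real^'d::finite^'m::finite \<Rightarrow> ('n::finite \<Rightarrow> real) \<Rightarrow> ('n, 'm) profile \<Rightarrow> real^'m \<Rightarrow> real^'d \<Rightarrow> real" where
  "agent_utility \<E> \<gamma> \<theta> b a = (\<Sum>j\<in>UNIV. \<gamma> j * ((b + \<E> *v a) \<bullet> \<theta> j)) - (norm a)\<^sup>2 / 2"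

definition agent_action ::
  "real^'d::finite^'m::finite \<Rightarrow> ('n::finite \<Rightarrow> real) \<Rightarrow> ('n, 'm) profile \<Rightarrow> real^'d" where
  "agent_action \<E> \<gamma> \<theta> = transpose \<E> *v (\<Sum>j\<in>UNIV. \<gamma> j *\<^sub>R \<theta> j)"

text \<open>Whatever the baseline \<open>b\<close>, this action is the unique maximiser of the utility.\<close>

lemma agent_utility_complete_square:
  "agent_utility \<E> \<gamma> \<theta> b a =
     b \<bullet> (\<Sum>j\<in>UNIV. \<gamma> j *\<^sub>R \<theta> j) + (norm (agent_action \<E> \<gamma> \<theta>))\<^sup>2 / 2
     - (norm (a - agent_action \<E> \<gamma> \<theta>))\<^sup>2 / 2"
proof -
  let ?v = "\<Sum>j\<in>UNIV. \<gamma> j *\<^sub>R \<theta> j"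
  have "(\<Sum>j\<in>UNIV. \<gamma> j * ((b + \<E> *v a) \<bullet> \<theta> j)) = (b + \<E> *v a) \<bullet> ?v"
    by (simp add: inner_sum_right)
  also have "\<dots> = b \<bullet> ?v + a \<bullet> agent_action \<E> \<gamma> \<theta>"
    by (simp add: agent_action_def inner_add_left dot_lmul_matrix inner_commute
        flip: vector_transpose_matrix)
  finally show ?thesis
    by (simp add: agent_utility_def power2_norm_eq_inner inner_diff_left inner_diff_right
        inner_commute field_simps)
qed

lemma is_arg_max_agent_utility_iff:
  "is_arg_max (agent_utility \<E> \<gamma> \<theta> b) (\<lambda>_. True) a \<longleftrightarrow> a = agent_action \<E> \<gamma> \<theta>"
proof
  assume "is_arg_max (agent_utility \<E> \<gamma> \<theta> b) (\<lambda>_. True) a"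
  then have "\<not> agent_utility \<E> \<gamma> \<theta> b a < agent_utility \<E> \<gamma> \<theta> b (agent_action \<E> \<gamma> \<theta>)"
    by (simp add: is_arg_max_def)
  then show "a = agent_action \<E> \<gamma> \<theta>"
    by (simp add: agent_utility_complete_square)
next
  assume "a = agent_action \<E> \<gamma> \<theta>"
  then show "is_arg_max (agent_utility \<E> \<gamma> \<theta> b) (\<lambda>_. True) a"
    by (simp add: is_arg_max_def agent_utility_complete_square not_less)
qed

definition covariates ::
  "('w \<Rightarrow> real^'m::finite) \<Rightarrow> ('w \<Rightarrow> real^'d::finite^'m) \<Rightarrow> ('w \<Rightarrow> 'n::finite \<Rightarrow> real)
    \<Rightarrow> ('n, 'm) profile \<Rightarrow> 'w \<Rightarrow> real^'m" where
  "covariates B \<E>\<^sub>t \<gamma>\<^sub>t \<theta> \<omega> = B \<omega> + \<E>\<^sub>t \<omega> *v agent_action (\<E>\<^sub>t \<omega>) (\<gamma>\<^sub>t \<omega>) \<theta>"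

section \<open>Conditional probabilities\<close>

text \<open>A version of the conditional probability of the event \<open>P\<close> given the random variable \<open>V\<close>
  with values in the measurable space \<open>N\<close>.\<close>

definition prob_given ::
  "'w measure \<Rightarrow> 'v measure \<Rightarrow> ('w \<Rightarrow> 'v) \<Rightarrow> ('w \<Rightarrow> bool) \<Rightarrow> 'w \<Rightarrow> real" where
  "prob_given M N V P =
     real_cond_exp M (vimage_algebra (space M) V N) (indicator {\<omega> \<in> space M. P \<omega>})"

definition cond_indep_var ::
  "'w measure \<Rightarrow> 'y measure \<Rightarrow> ('w \<Rightarrow> 'y) \<Rightarrow> 'u measure \<Rightarrow> ('w \<Rightarrow> 'u)
    \<Rightarrow> 'v measure \<Rightarrow> ('w \<Rightarrow> 'v) \<Rightarrow> bool" where
  "cond_indep_var M N\<^sub>Y Y N\<^sub>U U N\<^sub>V V \<longleftrightarrow>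
     (\<forall>A \<in> sets N\<^sub>Y. \<forall>C \<in> sets N\<^sub>U. AE \<omega> in M.
        prob_given M N\<^sub>V V (\<lambda>\<omega>'. Y \<omega>' \<in> A \<and> U \<omega>' \<in> C) \<omega> =
        prob_given M N\<^sub>V V (\<lambda>\<omega>'. Y \<omega>' \<in> A) \<omega> * prob_given M N\<^sub>V V (\<lambda>\<omega>'. U \<omega>' \<in> C) \<omega>)"

text \<open>Density of the normal distribution with mean \<open>0\<close> and covariance matrix \<open>\<sigma>\<^sup>2 I\<close>.\<close>

definition isotropic_normal_density :: "real \<Rightarrow> real^'m::finite \<Rightarrow> real" where
  "isotropic_normal_density \<sigma> x =
     1 / sqrt (2 * pi * \<sigma>\<^sup>2) ^ CARD('m) * exp (- (norm x)\<^sup>2 / (2 * \<sigma>\<^sup>2))"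

section \<open>The round\<close>

text \<open>
  The agent's primitives \<open>B\<close>, \<open>\<E>\<^sub>t\<close>, \<open>\<gamma>\<^sub>t\<close> and \<open>noise\<close> do not depend on the deployed profile,
  whereas the selection statuses \<open>W \<theta> j\<close> and the compliance \<open>Z \<theta>\<close> are the ones realised when
  \<open>\<theta>\<close> is deployed. All of them live on a single probability space, so that the same baseline is
  used for all profiles. The joint law of statuses belonging to different profiles is left open.
  \<open>Z \<theta> \<omega> = None\<close> stands for the value \<open>0\<close> of the compliance variable.
\<close>

locale multi_dm_round = prob_space M for M :: "'w measure" +
  fixes B :: "'w \<Rightarrow> real^'m::finite"
    and \<E>\<^sub>t :: "'w \<Rightarrow> real^'d::finite^'m"
    and \<gamma>\<^sub>t :: "'w \<Rightarrow> 'n::finite \<Rightarrow> real"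
    and noise :: "'n \<Rightarrow> 'w \<Rightarrow> real"
    and \<delta> :: "'n \<Rightarrow> real^'m \<Rightarrow> real^'m \<Rightarrow> real"
    and W :: "('n, 'm) profile \<Rightarrow> 'n \<Rightarrow> 'w \<Rightarrow> bool"
    and Z :: "('n, 'm) profile \<Rightarrow> 'w \<Rightarrow> 'n option"
  assumes B_measurable: "B \<in> borel_measurable M"
    and conversion_measurable: "\<E>\<^sub>t \<in> borel_measurable M"
    and incentive_measurable: "\<And>j. (\<lambda>\<omega>. \<gamma>\<^sub>t \<omega> j) \<in> borel_measurable M"
    and incentive_nonneg: "\<And>\<omega> j. \<omega> \<in> space M \<Longrightarrow> 0 \<le> \<gamma>\<^sub>t \<omega> j"
    and noise_measurable: "\<And>j. noise j \<in> borel_measurable M"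
    and rule_measurable: "\<And>j p. \<delta> j p \<in> borel_measurable borel"
    and rule_range: "\<And>j p x. \<delta> j p x \<in> {0..1}"
    and W_measurable: "\<And>\<theta> j. W \<theta> j \<in> measurable M (count_space UNIV)"
    and W_bernoulli: "\<And>\<theta> j. AE \<omega> in M.
      prob_given M borel (covariates B \<E>\<^sub>t \<gamma>\<^sub>t \<theta>) (W \<theta> j) \<omega>
        = \<delta> j (\<theta> j) (covariates B \<E>\<^sub>t \<gamma>\<^sub>t \<theta> \<omega>)"
    and Z_measurable: "\<And>\<theta>. Z \<theta> \<in> measurable M (count_space UNIV)"
    and Z_positive_decision: "\<And>\<theta> \<omega> j. \<omega> \<in> space M \<Longrightarrow> Z \<theta> \<omega> = Some j \<Longrightarrow> W \<theta> j \<omega>"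

definition cBP ::
  "'w measure \<Rightarrow> ('w \<Rightarrow> real^'m::finite) \<Rightarrow> ('n \<Rightarrow> 'w \<Rightarrow> real) \<Rightarrow> ('n, 'm) profile
    \<Rightarrow> (('n, 'm) profile \<Rightarrow> 'w \<Rightarrow> 'n option) \<Rightarrow> 'n \<Rightarrow> ('n, 'm) profile \<Rightarrow> real" where
  "cBP M B noise \<theta>s Z i \<theta> =
     (\<integral>\<omega>. (B \<omega> \<bullet> \<theta>s i + noise i \<omega>) \<partial>uniform_measure M {\<omega> \<in> space M. Z \<theta> \<omega> = Some i})"

definition cBP_well_defined ::
  "'w measure \<Rightarrow> ('w \<Rightarrow> real^'m::finite) \<Rightarrow> ('n \<Rightarrow> 'w \<Rightarrow> real) \<Rightarrow> ('n, 'm) profile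
    \<Rightarrow> (('n, 'm) profile \<Rightarrow> 'w \<Rightarrow> 'n option) \<Rightarrow> 'n \<Rightarrow> ('n, 'm) profile \<Rightarrow> bool" where
  "cBP_well_defined M B noise \<theta>s Z i \<theta> \<longleftrightarrow>
     measure M {\<omega> \<in> space M. Z \<theta> \<omega> = Some i} > 0 \<and>
     integrable (uniform_measure M {\<omega> \<in> space M. Z \<theta> \<omega> = Some i})
       (\<lambda>\<omega>. B \<omega> \<bullet> \<theta>s i + noise i \<omega>)"

definition admission_chance ::
  "'w measure \<Rightarrow> ('w \<Rightarrow> real^'m::finite) \<Rightarrow> (('n, 'm) profile \<Rightarrow> 'n \<Rightarrow> 'w \<Rightarrow> bool)
    \<Rightarrow> 'n \<Rightarrow> ('n, 'm) profile \<Rightarrow> 'w \<Rightarrow> real" where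
  "admission_chance M B W i \<theta> = prob_given M borel B (W \<theta> i)"

definition theta_AO ::
  "real^'d::finite^'m::finite \<Rightarrow> ('n \<Rightarrow> real) \<Rightarrow> ('n \<Rightarrow> real^'m) \<Rightarrow> ('n, 'm) profile
    \<Rightarrow> 'n \<Rightarrow> real^'m" where
  "theta_AO \<E> \<gamma> \<alpha> \<theta>s j =
     (\<alpha> j + \<gamma> j *\<^sub>R ((\<E> ** transpose \<E>) *v \<theta>s j)) /\<^sub>R
       norm (\<alpha> j + \<gamma> j *\<^sub>R ((\<E> ** transpose \<E>) *v \<theta>s j))"

end

theory Submission
  imports Defs
begin

text \<open>
  As \<open>B\<close> and the covariates differ by a constant shift, they generate the same \<open>\<sigma>\<close>-algebra, so the
  admission chance of \<open>i\<close> is almost surely the selection rule evaluated at the covariates. By the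
  Lipschitz condition a drop of more than \<open>K > 0\<close> forces the predicted outcome to drop by at least
  \<open>K / L\<close>, that is \<open>B \<bullet> (\<theta>\<^sup>A\<^sup>O - \<theta>\<^sup>*) \<le> - K / L - \<lambda>\<close>, and the left-hand side is a centred Gaussian with
  standard deviation \<open>\<sigma> \<parallel>\<theta>\<^sup>A\<^sup>O - \<theta>\<^sup>*\<parallel>\<close>. By (2), \<open>\<theta>\<^sup>A\<^sup>O\<close> is the normalisation of \<open>\<E>\<E>\<^sup>T \<theta>\<^sup>*\<close>, and two
  applications of the Cauchy-Schwarz inequality give \<open>\<parallel>\<E>\<^sup>T \<theta>\<^sup>*\<parallel> \<le> \<parallel>\<E>\<^sup>T \<theta>\<^sup>A\<^sup>O\<parallel>\<close>; together with (3)
  this yields \<open>\<lambda> \<ge> 0\<close>.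
\<close>

section \<open>Isotropic normal vectors\<close>

text \<open>By Tonelli, the integral of a product density over a box splits into one-dimensional
  integrals. Boxes constrained in one coordinate give the marginals; boxes constrained in a set
  \<open>J\<close> of coordinates give independence.\<close>

lemma (in prob_space) distributed_prod_density:
  fixes X :: "'a \<Rightarrow> 'b::euclidean_space" and f :: "'b \<Rightarrow> real \<Rightarrow> real"
  assumes X: "distributed M lborel X (\<lambda>x. \<Prod>b\<in>Basis. f b (x \<bullet> b))"
    and [measurable]: "\<And>b. b \<in> Basis \<Longrightarrow> f b \<in> borel_measurable borel"
    and nonneg: "\<And>b x. b \<in> Basis \<Longrightarrow> 0 \<le> f b x"
    and integral: "\<And>b. b \<in> Basis \<Longrightarrow> (\<integral>\<^sup>+x. f b x \<partial>lborel) = 1"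
  shows "\<And>b. b \<in> Basis \<Longrightarrow> distributed M lborel (\<lambda>\<omega>. X \<omega> \<bullet> b) (f b)"
    and "indep_vars (\<lambda>_. borel) (\<lambda>b \<omega>. X \<omega> \<bullet> b) Basis"
proof -
  have X_meas [measurable]: "X \<in> borel_measurable M"
    using distributed_measurable[OF X] by simp
  have rect: "emeasure M {\<omega> \<in> space M. \<forall>b\<in>J. X \<omega> \<bullet> b \<in> A b} = (\<Prod>b\<in>J. emeasure (density lborel (f b)) (A b))"
    if J: "J \<subseteq> Basis" and A: "\<And>b. b \<in> J \<Longrightarrow> A b \<in> sets borel" for J A
  proof -
    \<comment> \<open>Coordinates outside \<open>J\<close> are left unconstrained, so that the box
      ranges over the whole basis; their factors later collapse to the total mass 1 of
      \<open>f b\<close>.\<close>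
    define A' where "A' b = (if b \<in> J then A b else UNIV)" for b
    have A' [measurable]: "A' b \<in> sets borel" for b
      using A by (simp add: A'_def)
    let ?S = "{x. \<forall>b\<in>Basis. x \<bullet> b \<in> A' b}"
    have S: "?S \<in> sets lborel"
      by measurable
    have "{\<omega> \<in> space M. \<forall>b\<in>J. X \<omega> \<bullet> b \<in> A b} = X -` ?S \<inter> space M"
      using J by (auto simp: A'_def split: if_splits)
    then have "emeasure M {\<omega> \<in> space M. \<forall>b\<in>J. X \<omega> \<bullet> b \<in> A b} =
        (\<integral>\<^sup>+x. ennreal (\<Prod>b\<in>Basis. f b (x \<bullet> b)) * indicator ?S x \<partial>lborel)"
      using distributed_emeasure[OF X S] by simp
    also have "\<dots> = (\<integral>\<^sup>+x. (\<Prod>b\<in>Basis. ennreal (f b (x \<bullet> b)) * indicator (A' b) (x \<bullet> b)) \<partial>lborel)"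
    proof (rule nn_integral_cong)
      fix x :: 'b
      have "indicator ?S x = (\<Prod>b\<in>Basis. indicator (A' b) (x \<bullet> b) :: ennreal)"
        by (auto simp: indicator_def prod_zero_iff intro!: prod.neutral)
      then show "ennreal (\<Prod>b\<in>Basis. f b (x \<bullet> b)) * indicator ?S x =
          (\<Prod>b\<in>Basis. ennreal (f b (x \<bullet> b)) * indicator (A' b) (x \<bullet> b))"
        by (simp add: prod.distrib prod_ennreal nonneg)
    qed
    also have "\<dots> = (\<Prod>b\<in>Basis. \<integral>\<^sup>+x. ennreal (f b x) * indicator (A' b) x \<partial>lborel)"
      by (rule nn_integral_lborel_prod) auto
    also have "\<dots> = (\<Prod>b\<in>J. \<integral>\<^sup>+x. ennreal (f b x) * indicator (A' b) x \<partial>lborel)"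
      using J by (intro prod.mono_neutral_right) (auto simp: A'_def integral)
    also have "\<dots> = (\<Prod>b\<in>J. emeasure (density lborel (f b)) (A b))"
      using J A by (intro prod.cong refl) (auto simp: emeasure_density A'_def subset_eq)
    finally show ?thesis .
  qed
  have marginal: "emeasure M ((\<lambda>\<omega>. X \<omega> \<bullet> b) -` A \<inter> space M) = emeasure (density lborel (f b)) A"
    if "b \<in> Basis" "A \<in> sets borel" for b A
    using rect[of "{b}" "\<lambda>_. A"] that by (simp add: vimage_def Int_def conj_commute)
  show "distributed M lborel (\<lambda>\<omega>. X \<omega> \<bullet> b) (f b)" if "b \<in> Basis" for b
    unfolding distributed_def
  proof (intro conjI)
    show "distr M lborel (\<lambda>\<omega>. X \<omega> \<bullet> b) = density lborel (\<lambda>x. ennreal (f b x))"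
      using that marginal by (intro measure_eqI) (auto simp: emeasure_distr)
  qed (use that in measurable)
  show "indep_vars (\<lambda>_. borel) (\<lambda>b \<omega>. X \<omega> \<bullet> b) Basis"
    unfolding indep_vars_def2 indep_sets_def
  proof (intro conjI ballI allI impI)
    fix J :: "'b set" and E
    assume J: "J \<subseteq> Basis" "J \<noteq> {}" "finite J"
      and E: "E \<in> (\<Pi> b\<in>J. {(\<lambda>\<omega>. X \<omega> \<bullet> b) -` A \<inter> space M |A. A \<in> sets borel})"
    then have "\<forall>b\<in>J. \<exists>A. A \<in> sets borel \<and> E b = (\<lambda>\<omega>. X \<omega> \<bullet> b) -` A \<inter> space M"
      by (fastforce simp: Pi_iff)
    then obtain A where A: "\<And>b. b \<in> J \<Longrightarrow> A b \<in> sets borel"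
      and EA: "\<And>b. b \<in> J \<Longrightarrow> E b = (\<lambda>\<omega>. X \<omega> \<bullet> b) -` A b \<inter> space M"
      by metis
    have "(\<Inter>b\<in>J. E b) = {\<omega> \<in> space M. \<forall>b\<in>J. X \<omega> \<bullet> b \<in> A b}"
      using EA J(2) by auto
    then have "emeasure M (\<Inter>b\<in>J. E b) = (\<Prod>b\<in>J. emeasure (density lborel (f b)) (A b))"
      using rect[OF J(1) A] by simp
    also have "\<dots> = (\<Prod>b\<in>J. emeasure M (E b))"
      using J(1) A EA marginal by (intro prod.cong) auto
    finally show "prob (\<Inter>b\<in>J. E b) = (\<Prod>b\<in>J. prob (E b))"
      by (simp add: emeasure_eq_measure prod_ennreal prod_nonneg)
  qed auto
qed

lemma isotropic_normal_density_eq_prod: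
  fixes x :: "real^'m::finite"
  shows "isotropic_normal_density \<sigma> x = (\<Prod>b\<in>Basis. normal_density 0 \<sigma> (x \<bullet> b))"
proof -
  have "(\<Prod>b\<in>Basis. normal_density 0 \<sigma> (x \<bullet> b)) =
      1 / sqrt (2 * pi * \<sigma>\<^sup>2) ^ CARD('m) * exp (\<Sum>b\<in>Basis. - (x \<bullet> b)\<^sup>2 / (2 * \<sigma>\<^sup>2))"
    unfolding normal_density_def prod.distrib by (simp add: power_one_over exp_sum)
  also have "(\<Sum>b\<in>Basis. - (x \<bullet> b)\<^sup>2 / (2 * \<sigma>\<^sup>2)) = - (norm x)\<^sup>2 / (2 * \<sigma>\<^sup>2)"
    by (simp add: power2_norm_eq_inner euclidean_inner[of x x] sum_negf
        flip: sum_divide_distrib power2_eq_square)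
  finally show ?thesis
    by (simp add: isotropic_normal_density_def)
qed

text \<open>The density factorises, so the coordinates of \<open>X\<close> are independent centred
  normals. Scaled by the coordinates of \<open>w\<close> and summed, they stay normal, and the
  variances add up to \<open>\<sigma>\<^sup>2 * (norm w)\<^sup>2\<close>, which is positive as
  \<open>w\<close> is nonzero.\<close>

lemma (in prob_space) distributed_inner_isotropic_normal:
  fixes X :: "'a \<Rightarrow> real^'m::finite"
  assumes X: "distributed M lborel X (isotropic_normal_density \<sigma>)" and \<sigma>: "\<sigma> > 0"
    and w: "w \<noteq> 0"
  shows "distributed M lborel (\<lambda>\<omega>. X \<omega> \<bullet> w) (normal_density 0 (\<sigma> * norm w))"
proof -
  have integral: "(\<integral>\<^sup>+x. normal_density 0 \<sigma> x \<partial>lborel) = 1"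
    using \<sigma> by (subst nn_integral_eq_integral) auto
  have prod: "distributed M lborel X (\<lambda>x. \<Prod>b\<in>Basis. normal_density 0 \<sigma> (x \<bullet> b))"
    using X by (simp only: isotropic_normal_density_eq_prod)
  have marginal: "distributed M lborel (\<lambda>\<omega>. X \<omega> \<bullet> b) (normal_density 0 \<sigma>)" if "b \<in> Basis" for b
    by (rule distributed_prod_density(1)[OF prod _ _ _ that]) (rule integral | simp)+
  have indep: "indep_vars (\<lambda>_. borel) (\<lambda>b \<omega>. X \<omega> \<bullet> b) Basis"
    by (rule distributed_prod_density(2)[OF prod]) (rule integral | simp)+
  \<comment> \<open>Coordinates with vanishing weight are dropped because \<open>sum_indep_normal\<close> needs positive variances.\<close>
  define J where "J = {b \<in> Basis. w \<bullet> b \<noteq> 0}"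
  have J: "finite J" "J \<noteq> {}" "J \<subseteq> Basis"
    using w euclidean_all_zero_iff[of w] by (auto simp: J_def)
  have "distributed M lborel (\<lambda>\<omega>. \<Sum>b\<in>J. w \<bullet> b * (X \<omega> \<bullet> b))
      (normal_density (\<Sum>b\<in>J. 0) (sqrt (\<Sum>b\<in>J. (\<bar>w \<bullet> b\<bar> * \<sigma>)\<^sup>2)))"
  proof (rule sum_indep_normal)
    have "indep_vars (\<lambda>_. borel) (\<lambda>b \<omega>. X \<omega> \<bullet> b) J"
      using indep J(3) by (rule indep_vars_subset)
    then show "indep_vars (\<lambda>_. borel) (\<lambda>b \<omega>. w \<bullet> b * (X \<omega> \<bullet> b)) J"
      by (rule indep_vars_compose2) simp
    fix b assume b: "b \<in> J"
    then show "0 < \<bar>w \<bullet> b\<bar> * \<sigma>"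
      using \<sigma> by (simp add: J_def)
    show "distributed M lborel (\<lambda>\<omega>. w \<bullet> b * (X \<omega> \<bullet> b)) (normal_density 0 (\<bar>w \<bullet> b\<bar> * \<sigma>))"
      using normal_density_affine[OF marginal \<sigma>, of b "w \<bullet> b" 0] b by (auto simp: J_def)
  qed (use J in auto)
  moreover have "(\<Sum>b\<in>J. w \<bullet> b * (x \<bullet> b)) = x \<bullet> w" for x
    unfolding euclidean_inner[of x w]
    by (rule sum.mono_neutral_cong_left) (auto simp: J_def)
  moreover have "sqrt (\<Sum>b\<in>J. (\<bar>w \<bullet> b\<bar> * \<sigma>)\<^sup>2) = \<sigma> * norm w"
  proof -
    have "(\<Sum>b\<in>J. (\<bar>w \<bullet> b\<bar> * \<sigma>)\<^sup>2) = (\<Sum>b\<in>Basis. \<sigma>\<^sup>2 * (w \<bullet> b)\<^sup>2)"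
      by (rule sum.mono_neutral_cong_left) (auto simp: J_def power_mult_distrib)
    also have "\<dots> = (\<sigma> * norm w)\<^sup>2"
      by (simp add: power_mult_distrib power2_norm_eq_inner euclidean_inner[of w w]
          power2_eq_square[of "w \<bullet> _"] flip: sum_distrib_left)
    finally show ?thesis
      using \<sigma> by simp
  qed
  ultimately show ?thesis
    by simp
qed

lemma (in prob_space) prob_le_normal:
  assumes X: "distributed M lborel X (normal_density \<mu> \<sigma>)" and \<sigma>: "\<sigma> > 0"
  shows "prob {\<omega> \<in> space M. X \<omega> \<le> x} = cdf std_normal_distribution ((x - \<mu>) / \<sigma>)"
proof -
  let ?Y = "\<lambda>\<omega>. (X \<omega> - \<mu>) / \<sigma>"
  have Y: "distributed M lborel ?Y std_normal_density"
    using X normal_standard_normal_convert[OF \<sigma>] by simp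
  have "{\<omega> \<in> space M. X \<omega> \<le> x} = ?Y -` {..(x - \<mu>) / \<sigma>} \<inter> space M"
    using \<sigma> by (auto simp: divide_le_cancel)
  also have "prob \<dots> = measure (distr M lborel ?Y) {..(x - \<mu>) / \<sigma>}"
    using distributed_measurable[OF Y] by (subst measure_distr) auto
  also have "\<dots> = cdf std_normal_distribution ((x - \<mu>) / \<sigma>)"
    by (simp add: distributed_distr_eq_density[OF Y] cdf_def)
  finally show ?thesis .
qed

section \<open>Admission chances\<close>

lemma vimage_algebra_translation:
  fixes f g :: "'a \<Rightarrow> 'b::euclidean_space"
  assumes "\<And>x. x \<in> S \<Longrightarrow> f x = g x + v"
  shows "vimage_algebra S f borel = vimage_algebra S g borel"
proof -
  \<comment> \<open>Stated for arbitrary \<open>f\<close>, \<open>g\<close> and \<open>v\<close>, so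
    that the reverse inclusion follows by swapping the functions and shifting by
    \<open>- v\<close>.\<close>
  have subset: "{f -` A \<inter> S |A. A \<in> sets borel} \<subseteq> {g -` A \<inter> S |A. A \<in> sets borel}"
    if eq: "\<And>x. x \<in> S \<Longrightarrow> f x = g x + v" for f g :: "'a \<Rightarrow> 'b" and v
  proof clarify
    fix A :: "'b set" assume A: "A \<in> sets borel"
    have "(\<lambda>y. y + v) -` A \<inter> space borel \<in> sets borel"
      by (rule measurable_sets[OF _ A]) simp
    moreover have "f -` A \<inter> S = g -` ((\<lambda>y. y + v) -` A) \<inter> S"
      using eq by auto
    ultimately show "\<exists>A'. f -` A \<inter> S = g -` A' \<inter> S \<and> A' \<in> sets borel"
      by auto
  qed
  have "{f -` A \<inter> S |A. A \<in> sets borel} = {g -` A \<inter> S |A. A \<in> sets borel}"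
    using subset[of f g v] subset[of g f "- v"] assms by force
  then show ?thesis
    by (simp add: vimage_algebra_def)
qed

text \<open>The Bernoulli assumption conditions on the covariates, the admission chance on the
  baseline. With a common conversion matrix and common incentives the action is deterministic, so
  the two differ by a constant and \<open>prob_given\<close>, which sees the conditioning variable
  only through its \<sigma>-algebra, gives the same function.\<close>

lemma (in multi_dm_round) admission_chance_eq_rule:
  assumes conversion: "\<And>\<omega>. \<omega> \<in> space M \<Longrightarrow> \<E>\<^sub>t \<omega> = \<E>"
    and incentive: "\<And>\<omega> j. \<omega> \<in> space M \<Longrightarrow> \<gamma>\<^sub>t \<omega> j = \<gamma> j"
  shows "AE \<omega> in M. admission_chance M B W i \<theta> \<omega> =
    \<delta> i (\<theta> i) (B \<omega> + \<E> *v agent_action \<E> \<gamma> \<theta>)"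
proof -
  have covariates: "covariates B \<E>\<^sub>t \<gamma>\<^sub>t \<theta> \<omega> = B \<omega> + \<E> *v agent_action \<E> \<gamma> \<theta>"
    if "\<omega> \<in> space M" for \<omega>
    using conversion[OF that] incentive[OF that]
    by (simp add: covariates_def agent_action_def)
  have "vimage_algebra (space M) (covariates B \<E>\<^sub>t \<gamma>\<^sub>t \<theta>) borel = vimage_algebra (space M) B borel"
    using covariates by (rule vimage_algebra_translation)
  then have "admission_chance M B W i \<theta> =
      prob_given M borel (covariates B \<E>\<^sub>t \<gamma>\<^sub>t \<theta>) (W \<theta> i)"
    by (simp add: admission_chance_def prob_given_def)
  then show ?thesis
    using W_bernoulli[of \<theta> i] by (auto simp: covariates elim!: eventually_rev_mp intro!: AE_I2)
qed

text \<open>The Lipschitz bound controls only the distance of \<open>y\<close> and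
  \<open>y'\<close>; monotonicity and \<open>K > 0\<close> fix the sign.\<close>

lemma Lipschitz_mono_drop:
  fixes f :: "real \<Rightarrow> real"
  assumes "mono f" "L > 0" "\<bar>f y - f y'\<bar> \<le> L * \<bar>y - y'\<bar>" "f y - f y' > K" "K > 0"
  shows "y - y' > K / L"
proof -
  have "y' < y"
    using assms(4,5) monoD[OF assms(1), of y y'] by linarith
  then show ?thesis
    using assms by (simp add: pos_divide_less_eq mult.commute)
qed

section \<open>Improvement by the normalised gradient\<close>

lemma inner_matrix_transpose:
  fixes E :: "real^'d::finite^'m::finite"
  shows "x \<bullet> ((E ** transpose E) *v y) = (transpose E *v x) \<bullet> (transpose E *v y)"
  by (metis dot_lmul_matrix matrix_vector_mul_assoc transpose_matrix_vector)

text \<open>Put \<open>v = transpose E *v x\<close>, so that \<open>u = E *v v\<close>.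
  Cauchy-Schwarz on \<open>x \<bullet> u\<close> gives \<open>(norm v)\<^sup>2 \<le> norm u\<close>,
  and on \<open>(transpose E *v u) \<bullet> v\<close> it bounds \<open>(norm u)\<^sup>2\<close>.
  Chaining the two and cancelling \<open>norm v\<close> leaves the claim multiplied by
  \<open>norm u\<close>.\<close>

lemma norm_transpose_le_normalized:
  fixes E :: "real^'d::finite^'m::finite"
  assumes x: "norm x \<le> 1" and u: "u = (E ** transpose E) *v x" "u \<noteq> 0"
  shows "norm (transpose E *v x) \<le> norm (transpose E *v (u /\<^sub>R norm u))"
proof -
  define v where "v = transpose E *v x"
  have "v \<noteq> 0"
    using u by (auto simp: v_def simp flip: matrix_vector_mul_assoc)
  have "(norm v)\<^sup>2 = x \<bullet> u"
    by (simp add: v_def u(1) inner_matrix_transpose power2_norm_eq_inner)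
  also have "\<dots> \<le> norm x * norm u"
    by (rule norm_cauchy_schwarz)
  also have "\<dots> \<le> norm u"
    using x by (simp add: mult_left_le_one_le)
  finally have *: "(norm v)\<^sup>2 \<le> norm u" .
  have "norm u * (norm v)\<^sup>2 \<le> norm u * norm u"
    using * by (simp add: mult_left_mono)
  also have "norm u * norm u = u \<bullet> ((E ** transpose E) *v x)"
    using u(1) by (simp flip: power2_norm_eq_inner power2_eq_square)
  also have "\<dots> = (transpose E *v u) \<bullet> v"
    by (simp only: inner_matrix_transpose v_def)
  also have "\<dots> \<le> norm (transpose E *v u) * norm v"
    by (rule norm_cauchy_schwarz)
  finally have "norm u * norm v \<le> norm (transpose E *v u)"
    using \<open>v \<noteq> 0\<close> by (simp add: power2_eq_square mult.assoc[symmetric])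
  then show ?thesis
    using u(2) by (simp add: v_def matrix_vector_mult_scaleR field_simps)
qed

text \<open>The coefficients \<open>k - \<gamma> i\<close> and \<open>\<gamma> i\<close> add up to
  \<open>k\<close>, a positive factor that normalisation removes.\<close>

lemma theta_AO_aligned:
  assumes "\<alpha> i = (k - \<gamma> i) *\<^sub>R ((\<E> ** transpose \<E>) *v \<theta>s i)" "k > 0"
  shows "theta_AO \<E> \<gamma> \<alpha> \<theta>s i =
    ((\<E> ** transpose \<E>) *v \<theta>s i) /\<^sub>R norm ((\<E> ** transpose \<E>) *v \<theta>s i)"
proof -
  have "\<alpha> i + \<gamma> i *\<^sub>R ((\<E> ** transpose \<E>) *v \<theta>s i) = k *\<^sub>R ((\<E> ** transpose \<E>) *v \<theta>s i)"
    by (simp add: assms(1) algebra_simps)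
  then show ?thesis
    using assms(2) by (simp add: theta_AO_def)
qed

text \<open>Isolates the effort induced by \<open>i\<close> itself from the effort induced by the
  others, whose weights and parameters are the same in both deployments.\<close>

lemma agent_action_inner_upd:
  fixes \<theta> :: "('n::finite, 'm::finite) profile"
  shows "agent_action \<E> \<gamma> (\<theta>(i := x)) \<bullet> (transpose \<E> *v y) =
    \<gamma> i * (x \<bullet> ((\<E> ** transpose \<E>) *v y)) +
    (\<Sum>j\<in>- {i}. \<gamma> j * (\<theta> j \<bullet> ((\<E> ** transpose \<E>) *v y)))"
proof -
  have "agent_action \<E> \<gamma> (\<theta>(i := x)) \<bullet> (transpose \<E> *v y) =
      (\<Sum>j\<in>UNIV. \<gamma> j * ((\<theta>(i := x)) j \<bullet> ((\<E> ** transpose \<E>) *v y)))"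
    by (simp only: agent_action_def inner_sum_left inner_scaleR_left flip: inner_matrix_transpose)
  then show ?thesis
    by (simp add: sum.remove[of UNIV i] Compl_eq_Diff_UNIV)
qed

theorem corollary3p7:
  fixes M :: "'w measure"
    and B :: "'w \<Rightarrow> real^'m::finite"
    and \<E>\<^sub>t :: "'w \<Rightarrow> real^'d::finite^'m"
    and \<gamma>\<^sub>t :: "'w \<Rightarrow> 'n::finite \<Rightarrow> real"
    and noise :: "'n \<Rightarrow> 'w \<Rightarrow> real"
    and \<delta> :: "'n \<Rightarrow> real^'m \<Rightarrow> real^'m \<Rightarrow> real"
    and W :: "('n, 'm) profile \<Rightarrow> 'n \<Rightarrow> 'w \<Rightarrow> bool"
    and Z :: "('n, 'm) profile \<Rightarrow> 'w \<Rightarrow> 'n option"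
    and \<theta>s \<theta> :: "('n, 'm) profile"
    and \<E> :: "real^'d^'m"
    and \<gamma> k \<beta> c :: "'n \<Rightarrow> real"
    and \<alpha> :: "'n \<Rightarrow> real^'m"
    and g :: "'n \<Rightarrow> real^'m \<Rightarrow> real"
    and h :: "'n \<Rightarrow> ('n, 'm) profile \<Rightarrow> real"
    and i :: 'n
    and \<sigma> L :: real
    and \<delta>' :: "real \<Rightarrow> real"
  assumes n_ge_2: "CARD('n) \<ge> 2"
    and setting: "multi_dm_round M B \<E>\<^sub>t \<gamma>\<^sub>t noise \<delta> W Z"
    and cBP_wd: "\<forall>j \<theta>'. admissible \<theta>' \<longrightarrow> cBP_well_defined M B noise \<theta>s Z j \<theta>'"
    and H1: "\<forall>\<omega>\<in>space M. \<E>\<^sub>t \<omega> = \<E>"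
    and H2_gamma: "\<forall>\<omega>\<in>space M. \<forall>j. \<gamma>\<^sub>t \<omega> j = \<gamma> j" "\<forall>j. \<gamma> j \<ge> 0"
    and H2_Z: "\<forall>\<theta>'. cond_indep_var M
                 (count_space UNIV) (Z \<theta>')
                 (borel \<Otimes>\<^sub>M borel) (\<lambda>\<omega>. (covariates B \<E>\<^sub>t \<gamma>\<^sub>t \<theta>' \<omega>, B \<omega>))
                 (count_space UNIV) (\<lambda>\<omega> j. W \<theta>' j \<omega>)"
    and M1: "\<forall>j \<theta>'. admissible \<theta>' \<longrightarrow>
               cBP M B noise \<theta>s Z j \<theta>' = g j (\<theta>' j) + h j (restrict \<theta>' (- {j})) + c j"
    and M2: "\<forall>j x. norm x \<le> 1 \<longrightarrow> g j x = \<alpha> j \<bullet> x + \<beta> j"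
    and AO_denominator: "\<forall>j. \<alpha> j + \<gamma> j *\<^sub>R ((\<E> ** transpose \<E>) *v \<theta>s j) \<noteq> 0"
    and two_choices: "\<forall>j. j \<noteq> i \<longrightarrow> \<theta> j \<in> {\<theta>s j, theta_AO \<E> \<gamma> \<alpha> \<theta>s j}"
    and M3: "\<forall>j. j \<noteq> i \<longrightarrow> norm (\<theta> j) \<le> 1"
    and AO_neq: "theta_AO \<E> \<gamma> \<alpha> \<theta>s i \<noteq> \<theta>s i"
    and a1: "norm (\<theta>s i) \<le> 1"
    and a2: "\<forall>j. \<alpha> j = (k j - \<gamma> j) *\<^sub>R ((\<E> ** transpose \<E>) *v \<theta>s j)"
            "\<forall>j. k j > 0 \<and> \<gamma> j > 0"
    and a3: "\<forall>j. j \<noteq> i \<longrightarrow>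
               \<theta> j \<bullet> ((\<E> ** transpose \<E>) *v (theta_AO \<E> \<gamma> \<alpha> \<theta>s i - \<theta>s i)) \<ge> 0"
    and a4: "\<sigma> > 0" "distributed M lborel B (isotropic_normal_density \<sigma>)"
    and a5: "\<forall>p x. \<delta> i p x = \<delta>' (x \<bullet> p)" "mono \<delta>'"
            "L > 0" "\<forall>y y'. \<bar>\<delta>' y - \<delta>' y'\<bar> \<le> L * \<bar>y - y'\<bar>"
  shows
    "let \<theta>AO = theta_AO \<E> \<gamma> \<alpha> \<theta>s i;
         bullet = \<theta>(i := \<theta>s i);
         diamond = \<theta>(i := \<theta>AO);
         \<xi> = admission_chance M B W i;
         lam = agent_action \<E> \<gamma> diamond \<bullet> (transpose \<E> *v \<theta>AO)
             - agent_action \<E> \<gamma> bullet \<bullet> (transpose \<E> *v \<theta>s i)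
     in lam \<ge> 0 \<and>
        (\<forall>K>0. measure M {\<omega> \<in> space M. \<xi> bullet \<omega> - \<xi> diamond \<omega> > K}
           \<le> cdf std_normal_distribution ((- K / L - lam) / (\<sigma> * norm (\<theta>AO - \<theta>s i))))"
proof -
  interpret multi_dm_round M B \<E>\<^sub>t \<gamma>\<^sub>t noise \<delta> W Z
    by (rule setting)
  define x y where "x = \<theta>s i" and "y = theta_AO \<E> \<gamma> \<alpha> \<theta>s i"
  let ?S = "\<E> ** transpose \<E>"
  let ?a = "\<lambda>z. agent_action \<E> \<gamma> (\<theta>(i := z))"
  let ?\<xi> = "\<lambda>z. admission_chance M B W i (\<theta>(i := z))"
  define lam where "lam = ?a y \<bullet> (transpose \<E> *v y) - ?a x \<bullet> (transpose \<E> *v x)"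

  \<comment> \<open>If this vector vanished, so would \<open>\<alpha> i\<close> by (2), and with it
    the denominator of \<open>theta_AO\<close>.\<close>
  have Sx: "?S *v x \<noteq> 0"
    using spec[OF AO_denominator, of i] a2(1) by (auto simp: x_def)
  have y: "y = (?S *v x) /\<^sub>R norm (?S *v x)"
    using theta_AO_aligned[of \<alpha> i "k i" \<gamma> \<E> \<theta>s] a2(2) by (simp add: a2(1)[rule_format] x_def y_def)
  have "norm (transpose \<E> *v x) \<le> norm (transpose \<E> *v y)"
    unfolding y using a1 Sx by (intro norm_transpose_le_normalized) (simp_all add: x_def)
  then have "x \<bullet> (?S *v x) \<le> y \<bullet> (?S *v y)"
    unfolding inner_matrix_transpose power2_norm_eq_inner[symmetric] by (simp add: power_mono)
  then have "\<gamma> i * (x \<bullet> (?S *v x)) \<le> \<gamma> i * (y \<bullet> (?S *v y))"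
    using H2_gamma(2) by (simp add: mult_left_mono)
  \<comment> \<open>Termwise, this is hypothesis (3) weighted by the nonnegative
    \<open>\<gamma> j\<close>.\<close>
  moreover have "(\<Sum>j\<in>- {i}. \<gamma> j * (\<theta> j \<bullet> (?S *v x))) \<le> (\<Sum>j\<in>- {i}. \<gamma> j * (\<theta> j \<bullet> (?S *v y)))"
    using a3 H2_gamma(2) unfolding x_def y_def
    by (intro sum_mono mult_left_mono)
      (auto simp: matrix_vector_mult_diff_distrib inner_diff_right)
  ultimately have "lam \<ge> 0"
    unfolding lam_def agent_action_inner_upd by linarith

  moreover have "measure M {\<omega> \<in> space M. ?\<xi> x \<omega> - ?\<xi> y \<omega> > K}
      \<le> cdf std_normal_distribution ((- K / L - lam) / (\<sigma> * norm (y - x)))" if "K > 0" for K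
  proof -
    have w: "y - x \<noteq> 0"
      using AO_neq by (simp add: x_def y_def)
    have [measurable]: "B \<in> borel_measurable M"
      by (rule B_measurable)
    \<comment> \<open>The predicted outcome is a baseline part plus a deterministic effort part; the
      effort parts for \<open>y\<close> and \<open>x\<close> differ by exactly
      \<open>lam\<close>.\<close>
    have outcome: "(b + \<E> *v ?a z) \<bullet> z = b \<bullet> z + ?a z \<bullet> (transpose \<E> *v z)" for b z
      by (metis dot_lmul_matrix inner_add_left inner_commute transpose_matrix_vector)
    have chance: "AE \<omega> in M. ?\<xi> z \<omega> = \<delta>' (B \<omega> \<bullet> z + ?a z \<bullet> (transpose \<E> *v z))" for z
      using admission_chance_eq_rule[of \<E> \<gamma> i "\<theta>(i := z)"] H1 H2_gamma(1)
      by (simp only: a5(1)[rule_format] fun_upd_same outcome)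
    have "measure M {\<omega> \<in> space M. ?\<xi> x \<omega> - ?\<xi> y \<omega> > K}
        \<le> measure M {\<omega> \<in> space M. B \<omega> \<bullet> (y - x) \<le> - K / L - lam}"
    \<comment> \<open>Admission chances are versions of conditional expectations, known only almost
      surely, so the inclusion of events is also only almost sure.\<close>
    proof (rule finite_measure_mono_AE)
      show "AE \<omega> in M. \<omega> \<in> {\<omega> \<in> space M. ?\<xi> x \<omega> - ?\<xi> y \<omega> > K} \<longrightarrow>
          \<omega> \<in> {\<omega> \<in> space M. B \<omega> \<bullet> (y - x) \<le> - K / L - lam}"
        using chance[of x] chance[of y]
      proof eventually_elim
        case (elim \<omega>)
        show ?case
        proof
          assume "\<omega> \<in> {\<omega> \<in> space M. ?\<xi> x \<omega> - ?\<xi> y \<omega> > K}"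
          then have \<omega>: "\<omega> \<in> space M" and drop: "?\<xi> x \<omega> - ?\<xi> y \<omega> > K"
            by auto
          have "B \<omega> \<bullet> x + ?a x \<bullet> (transpose \<E> *v x) - (B \<omega> \<bullet> y + ?a y \<bullet> (transpose \<E> *v y)) > K / L"
            by (rule Lipschitz_mono_drop[OF a5(2,3) a5(4)[rule_format] drop[unfolded elim] \<open>K > 0\<close>])
          \<comment> \<open>The inequality obtained is strict; it is relaxed to fit the closed
            half-line in the distribution function.\<close>
          then have "B \<omega> \<bullet> (y - x) \<le> - K / L - lam"
            unfolding lam_def inner_diff_right by simp
          with \<omega> show "\<omega> \<in> {\<omega> \<in> space M. B \<omega> \<bullet> (y - x) \<le> - K / L - lam}"
            by blast
        qed
      qed
    qed measurable
    \<comment> \<open>The trailing \<open>- 0\<close> is the mean of the projected baseline, in the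
      form \<open>prob_le_normal\<close> expects.\<close>
    also have "\<dots> = cdf std_normal_distribution ((- K / L - lam - 0) / (\<sigma> * norm (y - x)))"
      using distributed_inner_isotropic_normal[OF a4(2,1) w] a4(1) w
      by (intro prob_le_normal) auto
    finally show ?thesis
      by simp
  qed
  ultimately show ?thesis
    by (simp add: Let_def lam_def x_def y_def)
qed

end
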